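(* Let $\mathcal{M}'''_m$ be a meridian surface of parabolic type from the general class, with generating functions $f(u), g(u), \varphi(v)$. Then $\mathcal{M}'''_m$ has parallel normal bundle if and only if one of the following cases holds: (a) the meridian $m$ is defined by $$f(u)=\pm(cu+d)^{1/2},\qquad g(u)=\mp\frac{2}{3c^2}(cu+d)^{3/2}+a,$$ where $a$, $c$ and $d$ are constants; (b) $\kappa(v)$ is a constant $b\neq0$, and the meridian $m$ is determined by $f'=y(f)$, where $$y(t)=\frac{c+at}{t},\qquad a=\text{const}\neq0,\quad c=\text{const},$$ and $g(u)$ is defined by $g'(u)=-\dfrac{1}{2f'(u)}$.
   Context: $\mathbb{R}^4_1$ is the four-dimensional Minkowski space with metric $\langle\cdot,\cdot\rangle$ of signature $(3,1)$ and standard orthonormal frame $\{e_1,e_2,e_3,e_4\}$, $\langle e_1,e_1\rangle=\langle e_2,e_2\rangle=\langle e_3,e_3\rangle=1$, $\langle e_4,e_4\rangle=-1$. Put $\xi_1=\frac{e_3+e_4}{\sqrt2}$, $\xi_2=\frac{-e_3+e_4}{\sqrt2}$, so $\langle\xi_1,\xi_1\rangle=\langle\xi_2,\xi_2\rangle=0$, $\langle\xi_1,\xi_2\rangle=-1$. A meridian surface of parabolic type $\mathcal{M}'''_m$ is the spacelike surface $$z(u,v) = f(u)\,\varphi(v)\cos v\, e_1 + f(u)\,\varphi(v)\sin v\, e_2+ \left(f(u)\frac{\varphi(v)^2}{2}+g(u)\right)\xi_1 + f(u)\,\xi_2,\quad u\in I,\ v\in J,$$ where $I,J\subset\mathbb{R}$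 are intervals, $f,g:I\to\mathbb{R}$ and $\varphi:J\to\mathbb{R}$ are smooth, $f>0$, $-f'g'>0$ on $I$, and $\dot\varphi^2+\varphi^2>0$ on $J$ ($'=d/du$, dot $=d/dv$). The $u$-lines are congruent curves, called the meridians $m$, determined by $f,g$; they are assumed parameterized by arc length, i.e. $-2f'g'=1$. Their curvature is $\kappa_m(u)=\frac{f''(u)}{f'(u)}$. Put $$\kappa(v)=\frac{\varphi\ddot\varphi-2\dot\varphi^2-\varphi^2}{(\dot\varphi^2+\varphi^2)^{3/2}}.$$ The surface is from the general class if $\kappa_m(u)\,\kappa(v)\neq0$ for all $u\in I$, $v\in J$. The mean curvature vector field is $H=\frac12\operatorname{tr}\sigma$, where $\sigma$ is the second fundamental tensor. It is a standing assumption that $\langle H,H\rangle\neq0$ everywhere; put $\varepsilon=\operatorname{sign}\langle H,H\rangle$. Geometric frame: let $X=z_u$, $Y=\frac{z_v}{f\sqrt{\dot\varphi^2+\varphi^2}}$; the principal tangents are $x=\frac{X+Y}{\sqrt2}$, $y=\frac{-X+Y}{\sqrt2}$. Let $b$ be a smooth unit normal field collinear with $H$ ($\langle b,b\rangle=\varepsilon$) and $l$ a smooth normal field with $\langle b,l\rangle=0$, $\langle l,l\rangle=-\varepsilon$ (sign choices do not matter here; this vector field $b$ is unrelated to the constant $b$ in the claim). With $\nabla'$ the Levi-Civita connection of $\mathbb{R}^4_1$, put $\beta_1=\langle\nabla'_xb,l\rangle$, $\beta_2=\langle\nabla'_yb,l\rangle$. The surface has parallel normal bundle if and only if $\beta_1=\beta_2=0$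 identically; this characterization is taken as the definition. The condition "the meridian is determined by $f'=y(f)$" means $f'(u)=y(f(u))$ for all $u\in I$ (the function $y(t)$ is unrelated to the tangent field $y$). *)

theory Defs
  imports "HOL-Analysis.Analysis"
begin

section \<open>Minkowski space\<close>

definition mink :: "real ^ 4 \<Rightarrow> real ^ 4 \<Rightarrow> real" where
  "mink x y = x $ 1 * y $ 1 + x $ 2 * y $ 2 + x $ 3 * y $ 3 - x $ 4 * y $ 4"

definition e :: "4 \<Rightarrow> real ^ 4" where
  "e i = axis i 1"

definition \<xi>1 :: "real ^ 4" where
  "\<xi>1 = (1 / sqrt 2) *\<^sub>R (e 3 + e 4)"

definition \<xi>2 :: "real ^ 4" where
  "\<xi>2 = (1 / sqrt 2) *\<^sub>R (- e 3 + e 4)"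

section \<open>Smoothness\<close>

text \<open>All derivatives are taken within the domain, so that intervals need not be open;
  at interior points these are the ordinary derivatives. A map is smooth iff all its iterated
  directional derivatives exist and are differentiable.\<close>

primrec times_differentiable_on ::
    "nat \<Rightarrow> 'a::real_normed_vector set \<Rightarrow> ('a \<Rightarrow> 'b::real_normed_vector) \<Rightarrow> bool" where
  "times_differentiable_on 0 S h \<longleftrightarrow> continuous_on S h"
| "times_differentiable_on (Suc n) S h \<longleftrightarrow>
     h differentiable_on S \<and>
     (\<forall>w. times_differentiable_on n S (\<lambda>p. frechet_derivative h (at p within S) w))"

definition smooth_on :: "'a::real_normed_vector set \<Rightarrow> ('a \<Rightarrow> 'b::real_normed_vector) \<Rightarrow> bool" where
  "smooth_on S h \<longleftrightarrow> (\<forall>n. times_differentiable_on n S h)"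

definition nondegenerate_interval :: "real set \<Rightarrow> bool" where
  "nondegenerate_interval S \<longleftrightarrow> is_interval S \<and> interior S \<noteq> {}"

definition D1 :: "real set \<Rightarrow> (real \<Rightarrow> real) \<Rightarrow> real \<Rightarrow> real" where
  "D1 S h t = vector_derivative h (at t within S)"

definition D2 :: "real set \<Rightarrow> (real \<Rightarrow> real) \<Rightarrow> real \<Rightarrow> real" where
  "D2 S h = D1 S (D1 S h)"

section \<open>Parametrized surfaces in Minkowski space\<close>

text \<open>Vector fields along a surface \<open>z\<close> with parameter domain \<open>D\<close> are maps on \<open>D\<close>.\<close>

type_synonym field = "real \<times> real \<Rightarrow> real ^ 4"

definition tangent_space :: "(real \<times> real) set \<Rightarrow> field \<Rightarrow> real \<times> real \<Rightarrow> (real ^ 4) set" where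
  "tangent_space D z p = range (frechet_derivative z (at p within D))"

definition normal_space :: "(real \<times> real) set \<Rightarrow> field \<Rightarrow> real \<times> real \<Rightarrow> (real ^ 4) set" where
  "normal_space D z p = {n. \<forall>t \<in> tangent_space D z p. mink n t = 0}"

definition normal_part :: "(real \<times> real) set \<Rightarrow> field \<Rightarrow> real \<times> real \<Rightarrow> real ^ 4 \<Rightarrow> real ^ 4" where
  "normal_part D z p w = (THE n. n \<in> normal_space D z p \<and> w - n \<in> tangent_space D z p)"

text \<open>The flat Levi-Civita connection of the ambient space: the derivative of the field \<open>V\<close>
  along the surface in the direction of the tangent field \<open>W\<close>. The tangent vector \<open>W p\<close> is the
  image under the differential of \<open>z\<close> of a unique parameter direction \<open>\<zeta>\<close>, in which \<open>V\<close> is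
  differentiated.\<close>

definition nabla :: "(real \<times> real) set \<Rightarrow> field \<Rightarrow> field \<Rightarrow> field \<Rightarrow> field" where
  "nabla D z W V p =
     frechet_derivative V (at p within D) (THE \<zeta>. frechet_derivative z (at p within D) \<zeta> = W p)"

text \<open>The second fundamental tensor on tangent fields, by the Gauss formula.\<close>

definition second_form :: "(real \<times> real) set \<Rightarrow> field \<Rightarrow> field \<Rightarrow> field \<Rightarrow> field" where
  "second_form D z V W p = normal_part D z p (nabla D z V W p)"

section \<open>Meridian surfaces of parabolic type\<close>

definition meridian_surface ::
    "(real \<Rightarrow> real) \<Rightarrow> (real \<Rightarrow> real) \<Rightarrow> (real \<Rightarrow> real) \<Rightarrow> field" where
  "meridian_surface f g \<phi> = (\<lambda>(u, v).
     (f u * \<phi> v * cos v) *\<^sub>R e 1 + (f u * \<phi> v * sin v) *\<^sub>R e 2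
     + (f u * (\<phi> v)\<^sup>2 / 2 + g u) *\<^sub>R \<xi>1 + f u *\<^sub>R \<xi>2)"

definition meridian_data ::
    "real set \<Rightarrow> real set \<Rightarrow> (real \<Rightarrow> real) \<Rightarrow> (real \<Rightarrow> real) \<Rightarrow> (real \<Rightarrow> real) \<Rightarrow> bool" where
  "meridian_data I J f g \<phi> \<longleftrightarrow>
     nondegenerate_interval I \<and> nondegenerate_interval J \<and>
     smooth_on I f \<and> smooth_on I g \<and> smooth_on J \<phi> \<and>
     (\<forall>u\<in>I. f u > 0) \<and>
     (\<forall>u\<in>I. - D1 I f u * D1 I g u > 0) \<and>
     (\<forall>v\<in>J. (D1 J \<phi> v)\<^sup>2 + (\<phi> v)\<^sup>2 > 0)"

definition arc_length_meridian :: "real set \<Rightarrow> (real \<Rightarrow> real) \<Rightarrow> (real \<Rightarrow> real) \<Rightarrow> bool" where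
  "arc_length_meridian I f g \<longleftrightarrow> (\<forall>u\<in>I. - 2 * D1 I f u * D1 I g u = 1)"

definition kappa_m :: "real set \<Rightarrow> (real \<Rightarrow> real) \<Rightarrow> real \<Rightarrow> real" where
  "kappa_m I f u = D2 I f u / D1 I f u"

definition kappa :: "real set \<Rightarrow> (real \<Rightarrow> real) \<Rightarrow> real \<Rightarrow> real" where
  "kappa J \<phi> v = (\<phi> v * D2 J \<phi> v - 2 * (D1 J \<phi> v)\<^sup>2 - (\<phi> v)\<^sup>2)
     / ((D1 J \<phi> v)\<^sup>2 + (\<phi> v)\<^sup>2) powr (3 / 2)"

definition general_class ::
    "real set \<Rightarrow> real set \<Rightarrow> (real \<Rightarrow> real) \<Rightarrow> (real \<Rightarrow> real) \<Rightarrow> bool" where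
  "general_class I J f \<phi> \<longleftrightarrow> (\<forall>u\<in>I. \<forall>v\<in>J. kappa_m I f u * kappa J \<phi> v \<noteq> 0)"

definition frame_X ::
    "real set \<Rightarrow> real set \<Rightarrow> (real \<Rightarrow> real) \<Rightarrow> (real \<Rightarrow> real) \<Rightarrow> (real \<Rightarrow> real) \<Rightarrow> field" where
  "frame_X I J f g \<phi> p = frechet_derivative (meridian_surface f g \<phi>) (at p within I \<times> J) (1, 0)"

definition frame_Y ::
    "real set \<Rightarrow> real set \<Rightarrow> (real \<Rightarrow> real) \<Rightarrow> (real \<Rightarrow> real) \<Rightarrow> (real \<Rightarrow> real) \<Rightarrow> field" where
  "frame_Y I J f g \<phi> p =
     (1 / (f (fst p) * sqrt ((D1 J \<phi> (snd p))\<^sup>2 + (\<phi> (snd p))\<^sup>2)))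
     *\<^sub>R frechet_derivative (meridian_surface f g \<phi>) (at p within I \<times> J) (0, 1)"

text \<open>The trace of the second fundamental tensor is evaluated in the frame of \<open>X\<close> and \<open>Y\<close>,
  which is orthonormal when the meridians are parametrized by arc length.\<close>

definition mean_curvature ::
    "real set \<Rightarrow> real set \<Rightarrow> (real \<Rightarrow> real) \<Rightarrow> (real \<Rightarrow> real) \<Rightarrow> (real \<Rightarrow> real) \<Rightarrow> field" where
  "mean_curvature I J f g \<phi> p = (let z = meridian_surface f g \<phi>;
       X = frame_X I J f g \<phi>; Y = frame_Y I J f g \<phi>
     in (1 / 2) *\<^sub>R (second_form (I \<times> J) z X X p + second_form (I \<times> J) z Y Y p))"

definition principal_x ::
    "real set \<Rightarrow> real set \<Rightarrow> (real \<Rightarrow> real) \<Rightarrow> (real \<Rightarrow> real) \<Rightarrow> (real \<Rightarrow> real) \<Rightarrow> field" where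
  "principal_x I J f g \<phi> p = (1 / sqrt 2) *\<^sub>R (frame_X I J f g \<phi> p + frame_Y I J f g \<phi> p)"

definition principal_y ::
    "real set \<Rightarrow> real set \<Rightarrow> (real \<Rightarrow> real) \<Rightarrow> (real \<Rightarrow> real) \<Rightarrow> (real \<Rightarrow> real) \<Rightarrow> field" where
  "principal_y I J f g \<phi> p = (1 / sqrt 2) *\<^sub>R (- frame_X I J f g \<phi> p + frame_Y I J f g \<phi> p)"

text \<open>The normal fields \<open>b\<close>, \<open>l\<close> of a geometric frame; the frame is unique up to the signs of
  \<open>b\<close> and \<open>l\<close>.\<close>

definition geometric_normal_frame ::
    "real set \<Rightarrow> real set \<Rightarrow> (real \<Rightarrow> real) \<Rightarrow> (real \<Rightarrow> real) \<Rightarrow> (real \<Rightarrow> real)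
     \<Rightarrow> field \<Rightarrow> field \<Rightarrow> bool" where
  "geometric_normal_frame I J f g \<phi> b l \<longleftrightarrow>
     smooth_on (I \<times> J) b \<and> smooth_on (I \<times> J) l \<and>
     (\<forall>p \<in> I \<times> J.
        let H = mean_curvature I J f g \<phi> p; \<epsilon> = sgn (mink H H);
            N = normal_space (I \<times> J) (meridian_surface f g \<phi>) p
        in b p \<in> N \<and> l p \<in> N \<and> (\<exists>r. b p = r *\<^sub>R H) \<and>
           mink (b p) (b p) = \<epsilon> \<and> mink (b p) (l p) = 0 \<and> mink (l p) (l p) = - \<epsilon>)"

definition beta1 ::
    "real set \<Rightarrow> real set \<Rightarrow> (real \<Rightarrow> real) \<Rightarrow> (real \<Rightarrow> real) \<Rightarrow> (real \<Rightarrow> real)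
     \<Rightarrow> field \<Rightarrow> field \<Rightarrow> real \<times> real \<Rightarrow> real" where
  "beta1 I J f g \<phi> b l p =
     mink (nabla (I \<times> J) (meridian_surface f g \<phi>) (principal_x I J f g \<phi>) b p) (l p)"

definition beta2 ::
    "real set \<Rightarrow> real set \<Rightarrow> (real \<Rightarrow> real) \<Rightarrow> (real \<Rightarrow> real) \<Rightarrow> (real \<Rightarrow> real)
     \<Rightarrow> field \<Rightarrow> field \<Rightarrow> real \<times> real \<Rightarrow> real" where
  "beta2 I J f g \<phi> b l p =
     mink (nabla (I \<times> J) (meridian_surface f g \<phi>) (principal_y I J f g \<phi>) b p) (l p)"

definition parallel_normal_bundle ::
    "real set \<Rightarrow> real set \<Rightarrow> (real \<Rightarrow> real) \<Rightarrow> (real \<Rightarrow> real) \<Rightarrow> (real \<Rightarrow> real)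
     \<Rightarrow> field \<Rightarrow> field \<Rightarrow> bool" where
  "parallel_normal_bundle I J f g \<phi> b l \<longleftrightarrow>
     (\<forall>p \<in> I \<times> J. beta1 I J f g \<phi> b l p = 0 \<and> beta2 I J f g \<phi> b l p = 0)"

end

theory Submission
  imports Defs
begin

text \<open>
  Write \<open>z = f L + g \<xi>1\<close> with \<open>L\<close> a lightlike curve depending on \<open>v\<close> only. Rotating \<open>L'\<close> in the
  orthogonal complement of \<open>L\<close> and \<open>\<xi>1\<close> gives a spacelike unit normal \<open>N1\<close>, and \<open>N2 = f' L - g' \<xi>1\<close> is
  a timelike one; both are parallel in the normal bundle. In this frame
  \<open>2 f H = \<kappa> N1 + (f \<kappa>\<^sub>m + f') N2\<close>. Hence the normalized field \<open>b\<close> is parallel iff its two components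
  are constant, iff \<open>f \<kappa>\<^sub>m + f' = \<mu> \<kappa>\<close> for a constant \<open>\<mu>\<close>. As the left side depends on \<open>u\<close> and the right
  side on \<open>v\<close>, either \<open>f \<kappa>\<^sub>m + f' = 0\<close>, or both \<open>\<kappa>\<close> and \<open>f \<kappa>\<^sub>m + f'\<close> are nonzero constants. Finally
  \<open>f' (f \<kappa>\<^sub>m + f') = (f f')'\<close>, so \<open>f \<kappa>\<^sub>m + f' = a\<close> integrates to \<open>f f' = a f + c\<close>.
\<close>

section \<open>The Minkowski form and derivatives on intervals\<close>

text \<open>In finite dimension bilinearity implies boundedness. This form supplies the product rule
  for \<open>mink\<close> of two differentiable fields.\<close>

lemma bounded_bilinear_mink: "bounded_bilinear mink"
  unfolding bilinear_conv_bounded_bilinear[symmetric] bilinear_def linear_iff mink_def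
  by (simp add: algebra_simps)

lemmas mink_simps =
  bounded_bilinear.add_left[OF bounded_bilinear_mink]
  bounded_bilinear.add_right[OF bounded_bilinear_mink]
  bounded_bilinear.diff_left[OF bounded_bilinear_mink]
  bounded_bilinear.diff_right[OF bounded_bilinear_mink]
  bounded_bilinear.minus_left[OF bounded_bilinear_mink]
  bounded_bilinear.minus_right[OF bounded_bilinear_mink]
  bounded_bilinear.scaleR_left[OF bounded_bilinear_mink]
  bounded_bilinear.scaleR_right[OF bounded_bilinear_mink]
  bounded_bilinear.zero_left[OF bounded_bilinear_mink]
  bounded_bilinear.zero_right[OF bounded_bilinear_mink]

lemma mink_commute: "mink x y = mink y x"
  by (simp add: mink_def mult.commute)

lemma mink_basis [simp]:
  "mink (e 1) (e 1) = 1" "mink (e 2) (e 2) = 1" "mink (e 1) (e 2) = 0" "mink (e 2) (e 1) = 0"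
  "mink (e 1) \<xi>1 = 0" "mink (e 1) \<xi>2 = 0" "mink (e 2) \<xi>1 = 0" "mink (e 2) \<xi>2 = 0"
  "mink \<xi>1 (e 1) = 0" "mink \<xi>2 (e 1) = 0" "mink \<xi>1 (e 2) = 0" "mink \<xi>2 (e 2) = 0"
  "mink \<xi>1 \<xi>1 = 0" "mink \<xi>2 \<xi>2 = 0" "mink \<xi>1 \<xi>2 = - 1" "mink \<xi>2 \<xi>1 = - 1"
  by (simp_all add: mink_def e_def \<xi>1_def \<xi>2_def axis_def)

text \<open>The linear map sending the standard basis to an orthogonal frame is injective, hence onto.\<close>

lemma mink_orthogonal_expansion:
  assumes "mink a b = 0" "mink a c = 0" "mink a d = 0" "mink b c = 0" "mink b d = 0" "mink c d = 0"
    and nz: "mink a a \<noteq> 0" "mink b b \<noteq> 0" "mink c c \<noteq> 0" "mink d d \<noteq> 0"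
  shows "w = (mink w a / mink a a) *\<^sub>R a + (mink w b / mink b b) *\<^sub>R b
           + (mink w c / mink c c) *\<^sub>R c + (mink w d / mink d d) *\<^sub>R d"
proof -
  define T where "T = (\<lambda>x :: real ^ 4. (x $ 1) *\<^sub>R a + (x $ 2) *\<^sub>R b + (x $ 3) *\<^sub>R c + (x $ 4) *\<^sub>R d)"
  have orth: "mink b a = 0" "mink c a = 0" "mink d a = 0" "mink c b = 0" "mink d b = 0" "mink d c = 0"
    using assms(1-6) mink_commute by metis+
  have T: "mink (T x) a = x $ 1 * mink a a" "mink (T x) b = x $ 2 * mink b b"
    "mink (T x) c = x $ 3 * mink c c" "mink (T x) d = x $ 4 * mink d d" for x
    using assms(1-6) orth by (simp_all add: T_def mink_simps)
  have "linear T"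
    by (auto simp: T_def linear_iff algebra_simps)
  moreover have "x = 0" if "T x = 0" for x
    using T[of x] nz that by (simp add: mink_simps vec_eq_iff forall_4)
  ultimately have "surj T"
    by (intro linear_injective_imp_surjective) (auto simp: linear_injective_0)
  then obtain x where "w = T x" by (meson surjD)
  with T[of x] nz show ?thesis by (simp add: T_def)
qed

text \<open>A connected set with more than one point has no isolated point. Hence derivatives within
  the interval are unique even at its endpoints.\<close>

lemma nondegenerate_interval_at_within_neq_bot:
  assumes "nondegenerate_interval S" "t \<in> S"
  shows "at t within S \<noteq> bot"
proof -
  have "connected S" "S \<noteq> {t}"
    using assms(1) by (auto simp: nondegenerate_interval_def is_interval_connected)
  then show ?thesis
    using assms(2) connected_imp_perfect[of S t] by (auto simp: trivial_limit_within)
qed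

text \<open>The rectangle may contain boundary points and corners, but each of its points is
  approached inside it along both coordinate directions, which determines a linear map.\<close>

lemma has_derivative_within_Times_unique:
  fixes F :: "real \<times> real \<Rightarrow> 'a::real_normed_vector"
  assumes I: "at (fst p) within I \<noteq> bot" and J: "at (snd p) within J \<noteq> bot" and p: "p \<in> I \<times> J"
    and F: "(F has_derivative F1) (at p within I \<times> J)" "(F has_derivative F2) (at p within I \<times> J)"
  shows "F1 = F2"
proof (rule frechet_derivative_unique_within[OF F])
  fix i :: "real \<times> real" and \<epsilon> :: real
  assume i: "i \<in> Basis" and "\<epsilon> > 0"
  have pt: "\<exists>d. 0 < \<bar>d\<bar> \<and> \<bar>d\<bar> < \<epsilon> \<and> t + d \<in> S" if nb: "at t within S \<noteq> bot" for t S
  proof -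
    from nb \<open>\<epsilon> > 0\<close> obtain y where "y \<in> S" "y \<noteq> t" "dist y t < \<epsilon>"
      by (auto simp: trivial_limit_within islimpt_approachable)
    then show ?thesis by (intro exI[of _ "y - t"]) (auto simp: dist_real_def)
  qed
  show "\<exists>d. 0 < \<bar>d\<bar> \<and> \<bar>d\<bar> < \<epsilon> \<and> p + d *\<^sub>R i \<in> I \<times> J"
    using i pt[OF I] pt[OF J] p by (cases p) (auto simp: Basis_prod_def)
qed

text \<open>Bridge from the Frechet derivatives in \<open>smooth_on\<close> to one-variable
  derivatives: on the line, the directional derivative along 1 is \<open>D1\<close>.\<close>

lemma smooth_on_D1:
  assumes S: "nondegenerate_interval S" and h: "smooth_on S h" and t: "t \<in> S"
  shows "(h has_real_derivative D1 S h t) (at t within S)"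
    and "(D1 S h has_real_derivative D2 S h t) (at t within S)"
proof -
  \<comment> \<open>Order two makes \<open>h\<close> and its directional derivatives
    differentiable.\<close>
  note h2 = h[unfolded smooth_on_def, rule_format, of "Suc (Suc 0)"]
  have d: "h differentiable_on S" using h2 by simp
  have D: "(h has_vector_derivative D1 S h s) (at s within S)" if "s \<in> S" for s
    using d that by (simp add: D1_def vector_derivative_works[symmetric] differentiable_on_def)
  then show "(h has_real_derivative D1 S h t) (at t within S)"
    using t by (simp add: has_real_derivative_iff_has_vector_derivative)
  have eq: "frechet_derivative h (at s within S) 1 = D1 S h s" if "s \<in> S" for s
  proof -
    have "h differentiable (at s within S)"
      using d that by (simp add: differentiable_on_def)
    then have F: "(h has_derivative frechet_derivative h (at s within S)) (at s within S)"
      by (simp add: frechet_derivative_works)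
    have "frechet_derivative h (at s within S) = (\<lambda>x. x *\<^sub>R frechet_derivative h (at s within S) 1)"
    proof
      show "frechet_derivative h (at s within S) x = x *\<^sub>R frechet_derivative h (at s within S) 1" for x
        using linear_scale[OF has_derivative_linear[OF F], of x 1] by simp
    qed
    with F have "(h has_vector_derivative frechet_derivative h (at s within S) 1) (at s within S)"
      by (simp add: has_vector_derivative_def)
    from vector_derivative_unique_within[OF nondegenerate_interval_at_within_neq_bot[OF S that]
        this D[OF that]]
    show ?thesis .
  qed
  have "(\<lambda>p. frechet_derivative h (at p within S) 1) differentiable_on S"
    using h2 by simp
  then have "D1 S h differentiable_on S"
    unfolding differentiable_on_def
    using eq by (auto intro: differentiable_transform_within[OF _ zero_less_one])
  then show "(D1 S h has_real_derivative D2 S h t) (at t within S)"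
    using t by (simp add: has_real_derivative_iff_has_vector_derivative D2_def D1_def[of S "D1 S h"]
        vector_derivative_works[symmetric] differentiable_on_def)
qed

section \<open>The adapted orthonormal frame\<close>

text \<open>The fields \<open>z\<close>, \<open>X\<close> and \<open>N2\<close> all have this shape,
  with \<open>K\<close> the constant vector \<xi>1, so one product rule serves them all.\<close>

lemma has_derivative_ruled:
  assumes a: "(a has_real_derivative a') (at u within I)"
    and c: "(c has_real_derivative c') (at u within I)"
    and L: "(L has_vector_derivative L') (at v within J)"
  shows "((\<lambda>p. a (fst p) *\<^sub>R L (snd p) + c (fst p) *\<^sub>R K) has_derivative
    (\<lambda>q. fst q *\<^sub>R (a' *\<^sub>R L v + c' *\<^sub>R K) + snd q *\<^sub>R (a u *\<^sub>R L'))) (at (u, v) within I \<times> J)"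
proof -
  have fst: "((\<lambda>p. h (fst p)) has_derivative (\<lambda>q. fst q * h')) (at (u, v) within I \<times> J)"
    if "(h has_real_derivative h') (at u within I)" for h h'
  proof -
    have "(h has_derivative (\<lambda>t. t * h')) (at (fst (u, v)) within fst ` (I \<times> J))"
      using that[unfolded has_real_derivative_iff_has_vector_derivative has_vector_derivative_def]
      by (auto intro: has_derivative_subset)
    from has_derivative_in_compose[OF has_derivative_fst[OF has_derivative_ident] this]
    show ?thesis by simp
  qed
  have "(L has_derivative (\<lambda>t. t *\<^sub>R L')) (at (snd (u, v)) within snd ` (I \<times> J))"
    using L by (auto simp: has_vector_derivative_def intro: has_derivative_subset)
  from has_derivative_in_compose[OF has_derivative_snd[OF has_derivative_ident] this]
  have snd: "((\<lambda>p. L (snd p)) has_derivative (\<lambda>q. snd q *\<^sub>R L')) (at (u, v) within I \<times> J)"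
    by simp
  show ?thesis
    by (rule has_derivative_eq_rhs[OF has_derivative_add[OF has_derivative_scaleR[OF fst[OF a] snd]
            has_derivative_scaleR[OF fst[OF c] has_derivative_const]]])
      (simp add: fun_eq_iff algebra_simps)
qed

locale parabolic_meridian =
  fixes I J :: "real set" and f g \<phi> :: "real \<Rightarrow> real"
  assumes data: "meridian_data I J f g \<phi>"
    and arc: "arc_length_meridian I f g"
begin

abbreviation "f1 \<equiv> D1 I f"
abbreviation "f2 \<equiv> D2 I f"
abbreviation "g1 \<equiv> D1 I g"
abbreviation "g2 \<equiv> D2 I g"
abbreviation "\<phi>1 \<equiv> D1 J \<phi>"
abbreviation "\<phi>2 \<equiv> D2 J \<phi>"
abbreviation "z \<equiv> meridian_surface f g \<phi>"
abbreviation "K \<equiv> kappa J \<phi>"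

section \<open>The generating functions and the arc-length relation\<close>

lemma I: "nondegenerate_interval I" and J: "nondegenerate_interval J"
  and f_pos: "u \<in> I \<Longrightarrow> f u > 0"
  and f_deriv: "u \<in> I \<Longrightarrow> (f has_real_derivative f1 u) (at u within I)"
  and f1_deriv: "u \<in> I \<Longrightarrow> (f1 has_real_derivative f2 u) (at u within I)"
  and g_deriv: "u \<in> I \<Longrightarrow> (g has_real_derivative g1 u) (at u within I)"
  and g1_deriv: "u \<in> I \<Longrightarrow> (g1 has_real_derivative g2 u) (at u within I)"
  and \<phi>_deriv: "v \<in> J \<Longrightarrow> (\<phi> has_real_derivative \<phi>1 v) (at v within J)"
  and \<phi>1_deriv: "v \<in> J \<Longrightarrow> (\<phi>1 has_real_derivative \<phi>2 v) (at v within J)"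
  using data by (auto simp: meridian_data_def smooth_on_D1)

lemmas I_neq_bot = nondegenerate_interval_at_within_neq_bot[OF I]
lemmas J_neq_bot = nondegenerate_interval_at_within_neq_bot[OF J]

lemma f1_g1: "u \<in> I \<Longrightarrow> f1 u * g1 u = - 1 / 2"
  using arc by (fastforce simp: arc_length_meridian_def)

lemma f1_nz: "u \<in> I \<Longrightarrow> f1 u \<noteq> 0"
  using f1_g1 by fastforce

lemma g1_eq: "u \<in> I \<Longrightarrow> g1 u = - 1 / (2 * f1 u)"
  using f1_g1[of u] f1_nz[of u] by (simp add: field_simps)

text \<open>Since \<open>f1 * g1\<close> is constant, \<open>f1\<close> and \<open>g1\<close> have
  opposite logarithmic derivatives. This is what makes \<open>X\<close> and \<open>N2\<close>
  exchange roles under differentiation in u.\<close>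

lemma g2_eq:
  assumes "u \<in> I"
  shows "g2 u = - kappa_m I f u * g1 u"
proof -
  have "((\<lambda>u. - 1 / (2 * f1 u)) has_real_derivative f2 u / (2 * (f1 u)\<^sup>2)) (at u within I)"
    using f1_nz[OF assms] by (auto intro!: derivative_eq_intros f1_deriv assms simp: power2_eq_square)
  then have "(g1 has_real_derivative f2 u / (2 * (f1 u)\<^sup>2)) (at u within I)"
    by (rule has_field_derivative_transform_within[OF _ zero_less_one assms]) (simp add: g1_eq)
  then have "g2 u = f2 u / (2 * (f1 u)\<^sup>2)"
    using vector_derivative_unique_within[OF I_neq_bot[OF assms]] g1_deriv[OF assms]
    by (auto simp: has_real_derivative_iff_has_vector_derivative)
  with f1_nz[OF assms] g1_eq[OF assms] show ?thesis
    by (simp add: kappa_m_def power2_eq_square)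
qed

section \<open>The lightlike curve \<open>L\<close> and its derivatives\<close>

definition E :: "real \<Rightarrow> real" where
  "E v = (\<phi>1 v)\<^sup>2 + (\<phi> v)\<^sup>2"

lemma E_pos: "v \<in> J \<Longrightarrow> E v > 0"
  using data by (simp add: meridian_data_def E_def)

text \<open>The left side reappears in \<open>mink_LM\<close> as the product of \<open>L2\<close>
  and \<open>M\<close>, so \<open>K\<close> is the normalized component of the second derivative of
  \<open>L\<close> along \<open>M\<close>.\<close>

lemma kappa_E:
  assumes "v \<in> J"
  shows "\<phi> v * \<phi>2 v - 2 * (\<phi>1 v)\<^sup>2 - (\<phi> v)\<^sup>2 = K v * (E v * sqrt (E v))"
proof -
  have "E v powr (3 / 2) = E v powr (1 + 1 / 2)" by simp
  also have "\<dots> = E v * sqrt (E v)"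
    using E_pos[OF assms] by (subst powr_add) (simp add: powr_half_sqrt)
  finally have "K v = (\<phi> v * \<phi>2 v - 2 * (\<phi>1 v)\<^sup>2 - (\<phi> v)\<^sup>2) / (E v * sqrt (E v))"
    by (simp only: kappa_def E_def)
  with E_pos[OF assms] show ?thesis by simp
qed

text \<open>A curve in the light cone, normalized by \<open>mink (L v) \<xi>1 = - 1\<close>. It
  collects the coefficient of \<open>f\<close> in the surface, which leaves \<open>g\<close> times
  \<xi>1.\<close>

definition L :: "real \<Rightarrow> real ^ 4" where
  "L v = (\<phi> v * cos v) *\<^sub>R e 1 + (\<phi> v * sin v) *\<^sub>R e 2 + ((\<phi> v)\<^sup>2 / 2) *\<^sub>R \<xi>1 + \<xi>2"

definition L1 :: "real \<Rightarrow> real ^ 4" where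
  "L1 v = (\<phi>1 v * cos v - \<phi> v * sin v) *\<^sub>R e 1 + (\<phi>1 v * sin v + \<phi> v * cos v) *\<^sub>R e 2
     + (\<phi> v * \<phi>1 v) *\<^sub>R \<xi>1"

definition L2 :: "real \<Rightarrow> real ^ 4" where
  "L2 v = ((\<phi>2 v - \<phi> v) * cos v - 2 * \<phi>1 v * sin v) *\<^sub>R e 1
     + ((\<phi>2 v - \<phi> v) * sin v + 2 * \<phi>1 v * cos v) *\<^sub>R e 2 + ((\<phi>1 v)\<^sup>2 + \<phi> v * \<phi>2 v) *\<^sub>R \<xi>1"

text \<open>The planar part is that of \<open>L1\<close> after a quarter turn; the coefficient of
  \<xi>1 is chosen to make \<open>M\<close> orthogonal to \<open>L\<close>.\<close>

definition M :: "real \<Rightarrow> real ^ 4" where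
  "M v = (\<phi>1 v * sin v + \<phi> v * cos v) *\<^sub>R e 1 + (\<phi> v * sin v - \<phi>1 v * cos v) *\<^sub>R e 2
     + ((\<phi> v)\<^sup>2) *\<^sub>R \<xi>1"

definition M1 :: "real \<Rightarrow> real ^ 4" where
  "M1 v = ((\<phi>2 v - \<phi> v) * sin v + 2 * \<phi>1 v * cos v) *\<^sub>R e 1
     + (2 * \<phi>1 v * sin v - (\<phi>2 v - \<phi> v) * cos v) *\<^sub>R e 2 + (2 * \<phi> v * \<phi>1 v) *\<^sub>R \<xi>1"

lemma has_vector_derivative_frame:
  assumes "(a has_real_derivative a') (at t within S)" "(b has_real_derivative b') (at t within S)"
    "(c has_real_derivative c') (at t within S)"
  shows "((\<lambda>v. a v *\<^sub>R e 1 + b v *\<^sub>R e 2 + c v *\<^sub>R \<xi>1) has_vector_derivative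
    a' *\<^sub>R e 1 + b' *\<^sub>R e 2 + c' *\<^sub>R \<xi>1) (at t within S)"
  using assms[THEN has_vector_derivative_scaleR[OF _ has_vector_derivative_const]]
  by (auto intro!: has_vector_derivative_add)

lemma L_deriv:
  assumes "v \<in> J" shows "(L has_vector_derivative L1 v) (at v within J)"
  unfolding L_def[abs_def] L1_def has_vector_derivative_add_const
  by (rule has_vector_derivative_frame)
    (auto intro!: derivative_eq_intros \<phi>_deriv assms simp: algebra_simps)

lemma L1_deriv:
  assumes "v \<in> J" shows "(L1 has_vector_derivative L2 v) (at v within J)"
  unfolding L1_def[abs_def] L2_def
  by (rule has_vector_derivative_frame)
    (auto intro!: derivative_eq_intros \<phi>_deriv \<phi>1_deriv assms simp: algebra_simps power2_eq_square)

lemma M_deriv: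
  assumes "v \<in> J" shows "(M has_vector_derivative M1 v) (at v within J)"
  unfolding M_def[abs_def] M1_def
  by (rule has_vector_derivative_frame)
    (auto intro!: derivative_eq_intros \<phi>_deriv \<phi>1_deriv assms simp: algebra_simps power2_eq_square)

text \<open>Every product reduces to the Pythagorean identity for sine and cosine. The value
  \<open>E v\<close> is the squared length of both \<open>L1\<close> and \<open>M\<close>, and the
  last two products vanish, which makes \<open>N1\<close> parallel.\<close>

lemma mink_LM:
  "mink (L v) (L v) = 0" "mink (L v) (L1 v) = 0" "mink (L1 v) (L v) = 0"
  "mink (L1 v) (L1 v) = E v" "mink (L v) (M v) = 0" "mink (M v) (L v) = 0"
  "mink (L1 v) (M v) = 0" "mink (M v) (L1 v) = 0" "mink (M v) (M v) = E v"
  "mink (L v) \<xi>1 = - 1" "mink \<xi>1 (L v) = - 1" "mink (L1 v) \<xi>1 = 0" "mink \<xi>1 (L1 v) = 0"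
  "mink (M v) \<xi>1 = 0" "mink \<xi>1 (M v) = 0"
  "mink (L2 v) (L v) = - E v" "mink (L2 v) \<xi>1 = 0"
  "mink (L2 v) (M v) = \<phi> v * \<phi>2 v - 2 * (\<phi>1 v)\<^sup>2 - (\<phi> v)\<^sup>2"
  "mink (M1 v) (L v) = 0" "mink (M1 v) \<xi>1 = 0"
  by (simp_all add: L_def L1_def L2_def M_def M1_def E_def mink_simps)
    ((use sin_cos_squared_add[of v] in algebra) |
     (simp add: field_simps, use sin_cos_squared_add[of v] in algebra))+

section \<open>Differentiation on the parameter rectangle\<close>

abbreviation "D \<equiv> I \<times> J"

lemma has_derivative_unique:
  fixes F :: "real \<times> real \<Rightarrow> 'a::real_normed_vector"
  assumes "p \<in> D" "(F has_derivative F1) (at p within D)" "(F has_derivative F2) (at p within D)"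
  shows "F1 = F2"
  using assms has_derivative_within_Times_unique[of p I J] I_neq_bot J_neq_bot by auto

lemma frechet_derivative_eqI:
  fixes F :: "real \<times> real \<Rightarrow> 'a::real_normed_vector"
  assumes "p \<in> D" "(F has_derivative F') (at p within D)"
  shows "frechet_derivative F (at p within D) = F'"
  using assms has_derivative_unique differentiableI frechet_derivative_works by blast

lemma mink_derivative_const:
  assumes p: "p \<in> D"
    and F: "(F has_derivative dF) (at p within D)" and G: "(G has_derivative dG) (at p within D)"
    and const: "\<And>p. p \<in> D \<Longrightarrow> mink (F p) (G p) = c"
  shows "mink (F p) (dG q) + mink (dF q) (G p) = 0"
proof -
  have "((\<lambda>p. mink (F p) (G p)) has_derivative (\<lambda>q. 0)) (at p within D)"
    by (rule has_derivative_transform[OF p const has_derivative_const])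
  from fun_cong[OF has_derivative_unique[OF p
        bounded_bilinear.FDERIV[OF bounded_bilinear_mink F G] this], of q]
  show ?thesis .
qed

section \<open>The orthonormal frame and its derivatives\<close>

definition X :: field where
  "X p = f1 (fst p) *\<^sub>R L (snd p) + g1 (fst p) *\<^sub>R \<xi>1"

definition Y :: field where
  "Y p = (1 / sqrt (E (snd p))) *\<^sub>R L1 (snd p)"

definition N1 :: field where
  "N1 p = (1 / sqrt (E (snd p))) *\<^sub>R M (snd p)"

text \<open>Reversing the sign of the \<xi>1 term of \<open>X\<close> turns the squared length 1
  into -1 and gives a vector orthogonal to \<open>X\<close>, as both summands are lightlike.\<close>

definition N2 :: field where
  "N2 p = f1 (fst p) *\<^sub>R L (snd p) + (- g1 (fst p)) *\<^sub>R \<xi>1"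

lemma frame_table:
  assumes "p \<in> D"
  shows "mink (X p) (X p) = 1" "mink (Y p) (Y p) = 1" "mink (N1 p) (N1 p) = 1"
    "mink (N2 p) (N2 p) = - 1"
    "mink (X p) (Y p) = 0" "mink (X p) (N1 p) = 0" "mink (X p) (N2 p) = 0"
    "mink (Y p) (X p) = 0" "mink (Y p) (N1 p) = 0" "mink (Y p) (N2 p) = 0"
    "mink (N1 p) (X p) = 0" "mink (N1 p) (Y p) = 0" "mink (N1 p) (N2 p) = 0"
    "mink (N2 p) (X p) = 0" "mink (N2 p) (Y p) = 0" "mink (N2 p) (N1 p) = 0"
proof -
  have "E (snd p) > 0" "f1 (fst p) * g1 (fst p) = - 1 / 2"
    using assms E_pos f1_g1 by auto
  then show "mink (X p) (X p) = 1" "mink (Y p) (Y p) = 1" "mink (N1 p) (N1 p) = 1"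
    "mink (N2 p) (N2 p) = - 1"
    "mink (X p) (Y p) = 0" "mink (X p) (N1 p) = 0" "mink (X p) (N2 p) = 0"
    "mink (Y p) (X p) = 0" "mink (Y p) (N1 p) = 0" "mink (Y p) (N2 p) = 0"
    "mink (N1 p) (X p) = 0" "mink (N1 p) (Y p) = 0" "mink (N1 p) (N2 p) = 0"
    "mink (N2 p) (X p) = 0" "mink (N2 p) (Y p) = 0" "mink (N2 p) (N1 p) = 0"
    by (simp_all add: X_def Y_def N1_def N2_def mink_simps mink_LM mult.commute)
qed

lemma frame_expansion:
  assumes "p \<in> D"
  shows "w = mink w (X p) *\<^sub>R X p + mink w (Y p) *\<^sub>R Y p
    + mink w (N1 p) *\<^sub>R N1 p - mink w (N2 p) *\<^sub>R N2 p"
  using mink_orthogonal_expansion[of "X p" "Y p" "N1 p" "N2 p" w] frame_table[OF assms] by simp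

lemma z_eq: "z = (\<lambda>p. f (fst p) *\<^sub>R L (snd p) + g (fst p) *\<^sub>R \<xi>1)"
  by (auto simp: meridian_surface_def L_def algebra_simps)

lemma z_deriv:
  assumes "p \<in> D"
  shows "(z has_derivative
    (\<lambda>q. fst q *\<^sub>R X p + (snd q * (f (fst p) * sqrt (E (snd p)))) *\<^sub>R Y p)) (at p within D)"
proof -
  obtain u v where p: "p = (u, v)" "u \<in> I" "v \<in> J" using assms by auto
  have "(z has_derivative (\<lambda>q. fst q *\<^sub>R (f1 u *\<^sub>R L v + g1 u *\<^sub>R \<xi>1) + snd q *\<^sub>R (f u *\<^sub>R L1 v)))
      (at p within D)"
    unfolding z_eq p(1) by (rule has_derivative_ruled[OF f_deriv g_deriv L_deriv]) fact+
  then show ?thesis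
    using E_pos[OF p(3)] by (simp add: p(1) X_def Y_def)
qed

lemma X_deriv:
  assumes "p \<in> D"
  shows "(X has_derivative (\<lambda>q. (fst q * kappa_m I f (fst p)) *\<^sub>R N2 p
    + snd q *\<^sub>R (f1 (fst p) *\<^sub>R L1 (snd p)))) (at p within D)"
proof -
  obtain u v where p: "p = (u, v)" "u \<in> I" "v \<in> J" using assms by auto
  have f2: "f2 u = kappa_m I f u * f1 u"
    using f1_nz[OF p(2)] by (simp add: kappa_m_def)
  have "(X has_derivative (\<lambda>q. fst q *\<^sub>R (f2 u *\<^sub>R L v + g2 u *\<^sub>R \<xi>1) + snd q *\<^sub>R (f1 u *\<^sub>R L1 v)))
      (at p within D)"
    unfolding X_def[abs_def] p(1)
    by (rule has_derivative_ruled[OF f1_deriv g1_deriv L_deriv]) fact+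
  then show ?thesis
    using p by (simp add: N2_def g2_eq f2 algebra_simps)
qed

text \<open>Both terms are tangent, since \<open>L1\<close> is a multiple of \<open>Y\<close>; thus
  \<open>N2\<close> is parallel in the normal bundle.\<close>

lemma N2_deriv:
  assumes "p \<in> D"
  shows "(N2 has_derivative (\<lambda>q. (fst q * kappa_m I f (fst p)) *\<^sub>R X p
    + snd q *\<^sub>R (f1 (fst p) *\<^sub>R L1 (snd p)))) (at p within D)"
proof -
  obtain u v where p: "p = (u, v)" "u \<in> I" "v \<in> J" using assms by auto
  have f2: "f2 u = kappa_m I f u * f1 u"
    using f1_nz[OF p(2)] by (simp add: kappa_m_def)
  have "(N2 has_derivative
      (\<lambda>q. fst q *\<^sub>R (f2 u *\<^sub>R L v + (- g2 u) *\<^sub>R \<xi>1) + snd q *\<^sub>R (f1 u *\<^sub>R L1 v))) (at p within D)"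
    unfolding N2_def[abs_def] p(1)
    by (rule has_derivative_ruled[OF f1_deriv DERIV_minus[OF g1_deriv] L_deriv]) fact+
  then show ?thesis
    using p by (simp add: X_def g2_eq f2 algebra_simps)
qed

lemma inverse_sqrt_E_deriv:
  assumes "v \<in> J"
  obtains s where "((\<lambda>v. 1 / sqrt (E v)) has_real_derivative s) (at v within J)"
proof -
  have "(E has_real_derivative 2 * \<phi>1 v * \<phi>2 v + 2 * \<phi> v * \<phi>1 v) (at v within J)"
    unfolding E_def[abs_def] by (auto intro!: derivative_eq_intros \<phi>_deriv \<phi>1_deriv assms)
  from DERIV_chain2[OF DERIV_real_sqrt[OF E_pos[OF assms]] this]
  have "((\<lambda>v. sqrt (E v)) has_real_derivative
    inverse (sqrt (E v)) / 2 * (2 * \<phi>1 v * \<phi>2 v + 2 * \<phi> v * \<phi>1 v)) (at v within J)" .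
  from DERIV_inverse_fun[OF this] E_pos[OF assms] that show ?thesis
    by (auto simp: inverse_eq_divide)
qed

text \<open>The derivative \<open>s\<close> of the normalizing factor stays unspecified, because it
  only contributes a multiple of \<open>G\<close> itself: tangent when \<open>G\<close> is
  \<open>L1\<close>, and controlled by unit length when \<open>G\<close> is
  \<open>M\<close>.\<close>

lemma unit_field_deriv:
  assumes p: "p \<in> D" and G: "(G has_vector_derivative G') (at (snd p) within J)"
  obtains s where "((\<lambda>p. (1 / sqrt (E (snd p))) *\<^sub>R G (snd p)) has_derivative
    (\<lambda>q. snd q *\<^sub>R ((1 / sqrt (E (snd p))) *\<^sub>R G' + s *\<^sub>R G (snd p)))) (at p within D)"
proof -
  obtain u v where p': "p = (u, v)" "u \<in> I" "v \<in> J" using assms by auto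
  obtain s where s: "((\<lambda>v. 1 / sqrt (E v)) has_real_derivative s) (at v within J)"
    using inverse_sqrt_E_deriv[OF p'(3)] .
  have G: "(G has_vector_derivative G') (at v within J)" using G p' by simp
  from has_derivative_ruled[OF DERIV_const[of "1 :: real"] DERIV_const[of "0 :: real"] 
        has_vector_derivative_scaleR[OF s G], where I = I and u = u and K = 0]
  show ?thesis by (intro that[of s]) (simp add: p'(1))
qed

text \<open>Unit length excludes a component along \<open>N1\<close>, and \<open>M1\<close> is
  orthogonal to \<open>L\<close> and \<xi>1, which span \<open>N2\<close>; so \<open>N1\<close> is
  parallel in the normal bundle.\<close>

lemma N1_deriv:
  assumes p: "p \<in> D"
  obtains dN where "(N1 has_derivative dN) (at p within D)"
    "\<And>q. mink (dN q) (N1 p) = 0" "\<And>q. mink (dN q) (N2 p) = 0"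
proof -
  have "(M has_vector_derivative M1 (snd p)) (at (snd p) within J)"
    using p by (auto intro: M_deriv)
  from unit_field_deriv[OF p this] obtain s where s: "(N1 has_derivative
    (\<lambda>q. snd q *\<^sub>R ((1 / sqrt (E (snd p))) *\<^sub>R M1 (snd p) + s *\<^sub>R M (snd p)))) (at p within D)"
    unfolding N1_def[abs_def] .
  show ?thesis
  proof (rule that[OF s])
    fix q :: "real \<times> real"
    show "mink (snd q *\<^sub>R ((1 / sqrt (E (snd p))) *\<^sub>R M1 (snd p) + s *\<^sub>R M (snd p))) (N1 p) = 0"
      using mink_derivative_const[OF p s s frame_table(3), of q] mink_commute[of "N1 p"] by simp
    show "mink (snd q *\<^sub>R ((1 / sqrt (E (snd p))) *\<^sub>R M1 (snd p) + s *\<^sub>R M (snd p))) (N2 p) = 0"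
      by (simp add: N2_def mink_simps mink_LM)
  qed
qed

section \<open>Tangent space, normal projection and connection in the frame\<close>

lemma tangent_space_iff:
  assumes p: "p \<in> D"
  shows "t \<in> tangent_space D z p \<longleftrightarrow> (\<exists>\<alpha> \<beta>. t = \<alpha> *\<^sub>R X p + \<beta> *\<^sub>R Y p)"
proof -
  have nz: "f (fst p) * sqrt (E (snd p)) \<noteq> 0"
    using p f_pos E_pos by fastforce
  have "\<exists>q. t = fst q *\<^sub>R X p + (snd q * (f (fst p) * sqrt (E (snd p)))) *\<^sub>R Y p"
    if "t = \<alpha> *\<^sub>R X p + \<beta> *\<^sub>R Y p" for \<alpha> \<beta>
    using nz that by (intro exI[of _ "(\<alpha>, \<beta> / (f (fst p) * sqrt (E (snd p))))"]) simp
  then show ?thesis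
    by (auto simp: tangent_space_def frechet_derivative_eqI[OF p z_deriv[OF p]] image_iff)
qed

lemma normal_space_iff:
  assumes p: "p \<in> D"
  shows "n \<in> normal_space D z p \<longleftrightarrow> mink n (X p) = 0 \<and> mink n (Y p) = 0"
proof -
  have "X p \<in> tangent_space D z p" "Y p \<in> tangent_space D z p"
    using tangent_space_iff[OF p]
    by (metis add.right_neutral scaleR_one scaleR_zero_left, metis add.left_neutral scaleR_one scaleR_zero_left)
  then show ?thesis
    by (auto simp: normal_space_def tangent_space_iff[OF p] mink_simps)
qed

text \<open>The minus sign reflects that \<open>N2\<close> is timelike. Uniqueness follows by
  pairing with \<open>N1\<close> and \<open>N2\<close>, which do not see the tangent
  difference.\<close>

lemma normal_part_eq:
  assumes p: "p \<in> D"
  shows "normal_part D z p w = mink w (N1 p) *\<^sub>R N1 p - mink w (N2 p) *\<^sub>R N2 p"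
  unfolding normal_part_def
proof (rule the_equality)
  let ?n = "mink w (N1 p) *\<^sub>R N1 p - mink w (N2 p) *\<^sub>R N2 p"
  have "w - ?n = mink w (X p) *\<^sub>R X p + mink w (Y p) *\<^sub>R Y p"
    using frame_expansion[OF p, of w] by (simp add: algebra_simps)
  then show "?n \<in> normal_space D z p \<and> w - ?n \<in> tangent_space D z p"
    using frame_table[OF p] by (auto simp: normal_space_iff[OF p] tangent_space_iff[OF p] mink_simps)
next
  fix n assume n: "n \<in> normal_space D z p \<and> w - n \<in> tangent_space D z p"
  then obtain \<alpha> \<beta> where "w - n = \<alpha> *\<^sub>R X p + \<beta> *\<^sub>R Y p"
    by (auto simp: tangent_space_iff[OF p])
  then have "w = n + (\<alpha> *\<^sub>R X p + \<beta> *\<^sub>R Y p)" by (simp add: algebra_simps)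
  then have "mink n (N1 p) = mink w (N1 p)" "mink n (N2 p) = mink w (N2 p)"
    using frame_table[OF p] by (simp_all add: mink_simps)
  with n frame_expansion[OF p, of n] show "n = mink w (N1 p) *\<^sub>R N1 p - mink w (N2 p) *\<^sub>R N2 p"
    by (simp add: normal_space_iff[OF p])
qed

text \<open>Eliminates the definite description: pairing with \<open>X\<close> and \<open>Y\<close>
  recovers the parameter direction, and the scale of the second coordinate is the length of the
  v-derivative of \<open>z\<close>.\<close>

lemma nabla_eq:
  assumes p: "p \<in> D" and W: "W p = h *\<^sub>R X p + k *\<^sub>R Y p"
  shows "nabla D z W V p
    = frechet_derivative V (at p within D) (h, k / (f (fst p) * sqrt (E (snd p))))"
proof -
  have nz: "f (fst p) * sqrt (E (snd p)) \<noteq> 0"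
    using p f_pos E_pos by fastforce
  let ?dz = "\<lambda>q. fst q *\<^sub>R X p + (snd q * (f (fst p) * sqrt (E (snd p)))) *\<^sub>R Y p"
  have "(THE \<zeta>. ?dz \<zeta> = W p) = (h, k / (f (fst p) * sqrt (E (snd p))))"
  proof (rule the_equality)
    fix q assume q: "?dz q = W p"
    from arg_cong[OF q, of "\<lambda>w. mink w (X p)"] arg_cong[OF q, of "\<lambda>w. mink w (Y p)"] nz
    show "q = (h, k / (f (fst p) * sqrt (E (snd p))))"
      unfolding W by (simp add: mink_simps frame_table[OF p] prod_eq_iff nonzero_eq_divide_eq)
  qed (use nz W in simp)
  then show ?thesis
    by (simp add: nabla_def frechet_derivative_eqI[OF p z_deriv[OF p]])
qed

section \<open>The mean curvature vector\<close>

lemma frame_X_eq: "p \<in> D \<Longrightarrow> frame_X I J f g \<phi> p = X p"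
  by (simp add: frame_X_def frechet_derivative_eqI[OF _ z_deriv])

lemma frame_Y_eq:
  assumes "p \<in> D" shows "frame_Y I J f g \<phi> p = Y p"
proof -
  have "f (fst p) * sqrt (E (snd p)) \<noteq> 0"
    using assms f_pos E_pos by fastforce
  then show ?thesis
    by (simp add: frame_Y_def frechet_derivative_eqI[OF assms z_deriv[OF assms]] E_def[symmetric])
qed

text \<open>The coefficient of \<open>N2\<close> in the mean curvature vector scaled by
  \<open>2 * f\<close>; multiplied by \<open>f1\<close> it is the derivative of
  \<open>f * f1\<close>.\<close>

definition A :: "real \<Rightarrow> real" where
  "A u = f u * kappa_m I f u + f1 u"

lemma mean_curvature_eq:
  assumes p: "p \<in> D"
  shows "mean_curvature I J f g \<phi> p
    = (1 / (2 * f (fst p))) *\<^sub>R (K (snd p) *\<^sub>R N1 p + A (fst p) *\<^sub>R N2 p)"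
proof -
  obtain u v where p': "p = (u, v)" "u \<in> I" "v \<in> J" using p by auto
  have pos: "f u > 0" "E v > 0" using p' f_pos E_pos by auto
  let ?s = "sqrt (E v)"
  have ss: "?s * ?s = E v" "?s > 0" using pos by auto
  \<comment> \<open>The two fields agree only on \<open>D\<close>, which suffices for derivatives
    within \<open>D\<close>.\<close>
  have "(frame_X I J f g \<phi> has_derivative (\<lambda>q. (fst q * kappa_m I f (fst p)) *\<^sub>R N2 p
      + snd q *\<^sub>R (f1 (fst p) *\<^sub>R L1 (snd p)))) (at p within D)"
    by (rule has_derivative_transform[OF p frame_X_eq X_deriv[OF p]])
  from nabla_eq[OF p, of "frame_X I J f g \<phi>" 1 0] frechet_derivative_eqI[OF p this]
  have "nabla D z (frame_X I J f g \<phi>) (frame_X I J f g \<phi>) p = kappa_m I f u *\<^sub>R N2 p"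
    by (simp add: frame_X_eq p) (simp add: p')
  then have XX: "second_form D z (frame_X I J f g \<phi>) (frame_X I J f g \<phi>) p = kappa_m I f u *\<^sub>R N2 p"
    by (simp add: second_form_def normal_part_eq p mink_simps frame_table)
  have "(L1 has_vector_derivative L2 (snd p)) (at (snd p) within J)"
    using p by (auto intro: L1_deriv)
  from unit_field_deriv[OF p this] obtain s where "(Y has_derivative
    (\<lambda>q. snd q *\<^sub>R ((1 / sqrt (E (snd p))) *\<^sub>R L2 (snd p) + s *\<^sub>R L1 (snd p)))) (at p within D)"
    unfolding Y_def[abs_def] .
  from has_derivative_transform[OF p frame_Y_eq this]
  have "(frame_Y I J f g \<phi> has_derivative
    (\<lambda>q. snd q *\<^sub>R ((1 / sqrt (E (snd p))) *\<^sub>R L2 (snd p) + s *\<^sub>R L1 (snd p)))) (at p within D)" .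
  from nabla_eq[OF p, of "frame_Y I J f g \<phi>" 0 1] frechet_derivative_eqI[OF p this]
  have n: "nabla D z (frame_Y I J f g \<phi>) (frame_Y I J f g \<phi>) p
      = (1 / (f u * ?s)) *\<^sub>R ((1 / ?s) *\<^sub>R L2 v + s *\<^sub>R L1 v)"
    by (simp add: frame_Y_eq p) (simp add: p')
  have m1: "mink (nabla D z (frame_Y I J f g \<phi>) (frame_Y I J f g \<phi>) p) (N1 p)
      = (1 / (f u * ?s)) * ((1 / ?s) * ((1 / ?s) * (K v * (E v * ?s))))"
    using kappa_E[OF p'(3)] unfolding n by (simp add: p'(1) N1_def mink_simps mink_LM)
  have m2: "mink (nabla D z (frame_Y I J f g \<phi>) (frame_Y I J f g \<phi>) p) (N2 p)
      = (1 / (f u * ?s)) * ((1 / ?s) * (f1 u * - E v))"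
    unfolding n by (simp add: p'(1) N2_def mink_simps mink_LM)
  have c1: "(1 / (f u * ?s)) * ((1 / ?s) * ((1 / ?s) * (K v * (E v * ?s)))) = K v / f u"
    and c2: "(1 / (f u * ?s)) * ((1 / ?s) * (f1 u * - E v)) = - (f1 u / f u)"
    using ss pos by (simp_all add: field_simps del: real_sqrt_mult_self)
  \<comment> \<open>The unknown \<open>s\<close> has disappeared: it multiplies \<open>L1\<close>,
    which is orthogonal to both normals.\<close>
  have YY: "second_form D z (frame_Y I J f g \<phi>) (frame_Y I J f g \<phi>) p
      = (K v / f u) *\<^sub>R N1 p + (f1 u / f u) *\<^sub>R N2 p"
    unfolding second_form_def normal_part_eq[OF p] m1 m2 c1 c2 by simp
  have "A u / (2 * f u) = kappa_m I f u / 2 + f1 u / (2 * f u)"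
    using pos(1) by (simp add: A_def add_divide_distrib)
  then show ?thesis
    unfolding mean_curvature_def Let_def XX YY by (simp add: p' scaleR_add_left scaleR_add_right add_ac)
qed

section \<open>The parallel normal bundle condition\<close>

lemma normal_expansion:
  assumes p: "p \<in> D" and n: "n \<in> normal_space D z p"
  shows "n = mink n (N1 p) *\<^sub>R N1 p - mink n (N2 p) *\<^sub>R N2 p"
  using frame_expansion[OF p, of n] n by (simp add: normal_space_iff[OF p])

lemma convex_D: "convex D"
  using I J by (simp add: convex_Times nondegenerate_interval_def is_interval_convex_1)

lemma I_nonempty: "I \<noteq> {}" and J_nonempty: "J \<noteq> {}"
  using I J by (auto simp: nondegenerate_interval_def)

text \<open>The unit field \<open>b\<close> is determined up to sign by the ratio of its components,
  and collinearity with the mean curvature vector makes this ratio \<open>- A / K\<close>.\<close>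

lemma parallel_iff:
  assumes K: "\<And>v. v \<in> J \<Longrightarrow> K v \<noteq> 0"
    and H: "\<And>p. p \<in> D \<Longrightarrow> mink (mean_curvature I J f g \<phi> p) (mean_curvature I J f g \<phi> p) \<noteq> 0"
    and frame: "geometric_normal_frame I J f g \<phi> b l"
  shows "parallel_normal_bundle I J f g \<phi> b l \<longleftrightarrow> (\<exists>\<mu>. \<forall>u\<in>I. \<forall>v\<in>J. A u = \<mu> * K v)"
proof -
  define \<epsilon> where "\<epsilon> p = sgn (mink (mean_curvature I J f g \<phi> p) (mean_curvature I J f g \<phi> p))" for p
  define db where "db p = frechet_derivative b (at p within D)" for p
  have fr: "b p \<in> normal_space D z p" "l p \<in> normal_space D z p"
    "\<exists>r. b p = r *\<^sub>R mean_curvature I J f g \<phi> p"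
    "mink (b p) (b p) = \<epsilon> p" "mink (b p) (l p) = 0" "mink (l p) (l p) = - \<epsilon> p" if "p \<in> D" for p
    using frame that by (auto simp: geometric_normal_frame_def Let_def \<epsilon>_def)
  have \<epsilon>: "\<epsilon> p * \<epsilon> p = 1" "\<epsilon> p \<noteq> 0" if "p \<in> D" for p
    using H[OF that] by (auto simp: \<epsilon>_def sgn_if)
  have b_deriv: "(b has_derivative db p) (at p within D)" if "p \<in> D" for p
  proof -
    have "times_differentiable_on (Suc 0) D b"
      using frame by (simp add: geometric_normal_frame_def smooth_on_def)
    then show ?thesis
      using that unfolding db_def times_differentiable_on.simps differentiable_on_def
        frechet_derivative_works by blast
  qed
  have db_b: "mink (db p q) (b p) = 0" if p: "p \<in> D" for p q
  proof -
    \<comment> \<open>The sign of \<open>\<langle>b, b\<rangle>\<close> is only known pointwise; its square is constant.\<close>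
    let ?h = "\<lambda>p. mink (b p) (b p)"
    have h: "(?h has_derivative (\<lambda>q. mink (b p) (db p q) + mink (db p q) (b p))) (at p within D)"
      by (rule bounded_bilinear.FDERIV[OF bounded_bilinear_mink b_deriv[OF p] b_deriv[OF p]])
    have "((\<lambda>p. ?h p * ?h p) has_derivative (\<lambda>q. 0)) (at p within D)"
      by (rule has_derivative_transform[OF p _ has_derivative_const[of 1]]) (simp add: fr \<epsilon>)
    from fun_cong[OF has_derivative_unique[OF p has_derivative_mult[OF h h] this], of q]
    show ?thesis using \<epsilon>[OF p] by (simp add: fr p mink_commute[of "b p" "db p q"])
  qed
  \<comment> \<open>The principal directions form a basis of the parameter plane, so by linearity
    both coefficients vanish iff \<open>db\<close> has no component along \<open>l\<close> in any
    direction.\<close>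
  have beta: "beta1 I J f g \<phi> b l p = 0 \<and> beta2 I J f g \<phi> b l p = 0
      \<longleftrightarrow> (\<forall>q. mink (db p q) (l p) = 0)" if p: "p \<in> D" for p
  proof -
    define k where "k = 1 / sqrt 2 / (f (fst p) * sqrt (E (snd p)))"
    have k: "k \<noteq> 0"
      using p f_pos E_pos by (fastforce simp: k_def)
    have x: "principal_x I J f g \<phi> p = (1 / sqrt 2) *\<^sub>R X p + (1 / sqrt 2) *\<^sub>R Y p"
      and y: "principal_y I J f g \<phi> p = (- 1 / sqrt 2) *\<^sub>R X p + (1 / sqrt 2) *\<^sub>R Y p"
      by (simp_all add: principal_x_def principal_y_def frame_X_eq frame_Y_eq p scaleR_add_right scaleR_diff_right)
    interpret lin: linear "db p"
      using b_deriv[OF p] by (rule has_derivative_linear)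
    have db: "db p (s, t) = s *\<^sub>R db p (1, 0) + t *\<^sub>R db p (0, 1)" for s t
      using lin.add[of "(s, 0)" "(0, t)"] lin.scale[of s "(1, 0)"] lin.scale[of t "(0, 1)"] by simp
    have b1: "beta1 I J f g \<phi> b l p
        = (1 / sqrt 2) * mink (db p (1, 0)) (l p) + k * mink (db p (0, 1)) (l p)"
      unfolding beta1_def nabla_eq[where W = "principal_x I J f g \<phi>", OF p x] db_def[symmetric] k_def[symmetric]
      by (subst db) (simp add: mink_simps)
    have b2: "beta2 I J f g \<phi> b l p
        = (- 1 / sqrt 2) * mink (db p (1, 0)) (l p) + k * mink (db p (0, 1)) (l p)"
      unfolding beta2_def nabla_eq[where W = "principal_y I J f g \<phi>", OF p y] db_def[symmetric] k_def[symmetric]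
      by (subst db) (simp add: mink_simps)
    have "beta1 I J f g \<phi> b l p = 0 \<and> beta2 I J f g \<phi> b l p = 0
        \<longleftrightarrow> mink (db p (1, 0)) (l p) = 0 \<and> mink (db p (0, 1)) (l p) = 0"
    proof -
      \<comment> \<open>Adding and subtracting the two equations isolates \<open>y\<close> and
        \<open>x\<close>.\<close>
      have "s * x + k * y = 0 \<and> - s * x + k * y = 0 \<longleftrightarrow> x = 0 \<and> y = 0" if "s \<noteq> 0" for s x y :: real
        using that k by auto
      from this[of "1 / sqrt 2"] show ?thesis unfolding b1 b2 by simp
    qed
    also have "\<dots> \<longleftrightarrow> (\<forall>q. mink (db p q) (l p) = 0)"
    proof
      assume "mink (db p (1, 0)) (l p) = 0 \<and> mink (db p (0, 1)) (l p) = 0"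
      then have "mink (db p (s, t)) (l p) = 0" for s t
        by (subst db) (simp add: mink_simps)
      then show "\<forall>q. mink (db p q) (l p) = 0" by simp
    qed blast
    finally show ?thesis .
  qed
  define B1 where "B1 p = mink (b p) (N1 p)" for p
  define B2 where "B2 p = mink (b p) (N2 p)" for p
  have b_eq: "b p = B1 p *\<^sub>R N1 p - B2 p *\<^sub>R N2 p" if "p \<in> D" for p
    using normal_expansion[OF that fr(1)[OF that]] by (simp add: B1_def B2_def)
  have B1_deriv: "(B1 has_derivative (\<lambda>q. mink (db p q) (N1 p))) (at p within D)" if p: "p \<in> D" for p
  proof -
    obtain dN where dN: "(N1 has_derivative dN) (at p within D)"
      "\<And>q. mink (dN q) (N1 p) = 0" "\<And>q. mink (dN q) (N2 p) = 0"
      using N1_deriv[OF p] by blast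
    \<comment> \<open>Parallelism of \<open>N1\<close> removes the second term of the product rule,
      so only the derivative of \<open>b\<close> contributes.\<close>
    have "mink (b p) (dN q) = 0" for q
      using dN(2,3)[of q] by (simp add: b_eq[OF p] mink_simps mink_commute[of _ "dN q"])
    then show ?thesis
      using bounded_bilinear.FDERIV[OF bounded_bilinear_mink b_deriv[OF p] dN(1)]
      by (simp add: B1_def[abs_def])
  qed
  have B2_deriv: "(B2 has_derivative (\<lambda>q. mink (db p q) (N2 p))) (at p within D)" if p: "p \<in> D" for p
  proof -
    have "L1 (snd p) = sqrt (E (snd p)) *\<^sub>R Y p"
      using p E_pos by (fastforce simp: Y_def)
    then have "mink (b p) (L1 (snd p)) = 0" "mink (b p) (X p) = 0"
      using fr(1)[OF p] by (simp_all add: normal_space_iff[OF p] mink_simps)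
    then show ?thesis
      using bounded_bilinear.FDERIV[OF bounded_bilinear_mink b_deriv[OF p] N2_deriv[OF p]]
      by (simp add: B2_def[abs_def] mink_simps)
  qed
  have B_AK: "B1 p * A (fst p) = - B2 p * K (snd p)" and B1_nz: "B1 p \<noteq> 0" if p: "p \<in> D" for p
  proof -
    obtain r where r: "b p = r *\<^sub>R mean_curvature I J f g \<phi> p" using fr(3)[OF p] by blast
    have f: "f (fst p) > 0" using p f_pos by auto
    have "r \<noteq> 0" using r fr(4)[OF p] \<epsilon>[OF p] by (auto simp: mink_simps)
    moreover have "K (snd p) \<noteq> 0" using p K by auto
    moreover have B: "B1 p = r / (2 * f (fst p)) * K (snd p)" "B2 p = - r / (2 * f (fst p)) * A (fst p)"
      by (simp_all add: B1_def B2_def r mean_curvature_eq p mink_simps frame_table)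
    ultimately show "B1 p \<noteq> 0" using f by simp
    show "B1 p * A (fst p) = - B2 p * K (snd p)" unfolding B by simp
  qed
  have norm_b: "B1 p * B1 p - B2 p * B2 p \<noteq> 0" if "p \<in> D" for p
  proof -
    have "\<epsilon> p = B1 p * B1 p - B2 p * B2 p"
      using fr(4)[OF that] by (simp add: b_eq[OF that] mink_simps frame_table[OF that])
    with \<epsilon>(2)[OF that] show ?thesis by simp
  qed
  show ?thesis
  proof
    assume "parallel_normal_bundle I J f g \<phi> b l"
    then have db_l: "mink (db p q) (l p) = 0" if "p \<in> D" for p q
      using beta that unfolding parallel_normal_bundle_def by blast
    \<comment> \<open>The normal plane is spanned by \<open>b\<close> and \<open>l\<close>:
      \<open>db\<close> is orthogonal to \<open>b\<close> by constant length and to \<open>l\<close>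
      by assumption.\<close>
    have "mink (db p q) n = 0" if p: "p \<in> D" and n: "n \<in> normal_space D z p" for p q n
    proof -
      have "mink (X p) (b p) = 0" "mink (X p) (l p) = 0" "mink (Y p) (b p) = 0" "mink (Y p) (l p) = 0"
        using fr(1,2)[OF p] by (simp_all add: normal_space_iff[OF p] mink_commute)
      then have "n = (mink n (b p) / \<epsilon> p) *\<^sub>R b p + (mink n (l p) / - \<epsilon> p) *\<^sub>R l p"
        using mink_orthogonal_expansion[of "X p" "Y p" "b p" "l p" n] n
        by (simp add: fr p \<epsilon> frame_table normal_space_iff)
      then obtain \<alpha> \<beta> where "n = \<alpha> *\<^sub>R b p + \<beta> *\<^sub>R l p" by blast
      then show ?thesis
        using db_l[OF p, of q] db_b[OF p, of q] by (simp add: mink_simps)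
    qed
    then have "mink (db p q) (N1 p) = 0" "mink (db p q) (N2 p) = 0" if "p \<in> D" for p q
      using that by (simp_all add: normal_space_iff frame_table)
    with B1_deriv B2_deriv have
      "p \<in> D \<Longrightarrow> (B1 has_derivative (\<lambda>q. 0)) (at p within D)"
      "p \<in> D \<Longrightarrow> (B2 has_derivative (\<lambda>q. 0)) (at p within D)" for p
      by auto
    then obtain c1 c2 where c: "\<And>p. p \<in> D \<Longrightarrow> B1 p = c1" "\<And>p. p \<in> D \<Longrightarrow> B2 p = c2"
      using has_derivative_zero_constant[OF convex_D] by metis
    have "A u = (- c2 / c1) * K v" if "u \<in> I" "v \<in> J" for u v
      using B_AK[of "(u, v)"] B1_nz[of "(u, v)"] c[of "(u, v)"] that by (simp add: field_simps)
    then show "\<exists>\<mu>. \<forall>u\<in>I. \<forall>v\<in>J. A u = \<mu> * K v" by blast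
  next
    assume "\<exists>\<mu>. \<forall>u\<in>I. \<forall>v\<in>J. A u = \<mu> * K v"
    then obtain \<mu> where \<mu>: "\<And>u v. u \<in> I \<Longrightarrow> v \<in> J \<Longrightarrow> A u = \<mu> * K v" by blast
    have B2: "B2 p = - \<mu> * B1 p" if "p \<in> D" for p
    proof -
      \<comment> \<open>Substituting for \<open>A\<close> in \<open>B_AK\<close> leaves a factor
        \<open>K\<close>, which is nonzero and cancels.\<close>
      have "K (snd p) * (B2 p + \<mu> * B1 p) = 0"
        using B_AK[OF that] \<mu>[of "fst p" "snd p"] that by (auto simp: algebra_simps)
      then show ?thesis using K that by auto
    qed
    have "mink (db p q) (l p) = 0" if p: "p \<in> D" for p q
    proof -
      have "(B2 has_derivative (\<lambda>q. - \<mu> * mink (db p q) (N1 p))) (at p within D)"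
        by (rule has_derivative_transform[OF p B2 has_derivative_mult_right[OF B1_deriv[OF p]]])
      from fun_cong[OF has_derivative_unique[OF p B2_deriv[OF p] this], of q]
      have d2: "mink (db p q) (N2 p) = - \<mu> * mink (db p q) (N1 p)" .
      have "B1 p * mink (db p q) (N1 p) - B2 p * mink (db p q) (N2 p) = 0"
        using db_b[OF p, of q] by (simp add: b_eq[OF p] mink_simps)
      \<comment> \<open>Proportional components and constant length give a homogeneous equation
        whose coefficient is the squared length of \<open>b\<close>, nonzero by
        \<open>norm_b\<close>.\<close>
      then have "(B1 p * B1 p - B2 p * B2 p) * mink (db p q) (N1 p) = 0"
        unfolding d2 B2[OF p] by algebra
      with norm_b[OF p] d2 have "mink (db p q) (N1 p) = 0" "mink (db p q) (N2 p) = 0" by auto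
      then show ?thesis
        by (subst normal_expansion[OF p fr(2)[OF p]]) (simp add: mink_simps)
    qed
    then show "parallel_normal_bundle I J f g \<phi> b l"
      using beta unfolding parallel_normal_bundle_def by blast
  qed
qed

section \<open>Integration of the meridian equations\<close>

lemma A_const_iff: "(\<forall>u\<in>I. A u = a) \<longleftrightarrow> (\<exists>c. \<forall>u\<in>I. f u * f1 u = a * f u + c)"
proof -
  \<comment> \<open>The factor \<open>f1\<close> never vanishes, so this derivative is zero exactly
    where \<open>A u = a\<close>; constancy on the convex set \<open>I\<close> then gives both
    directions.\<close>
  have d: "((\<lambda>u. f u * f1 u - a * f u) has_derivative (\<lambda>t. f1 u * (A u - a) * t)) (at u within I)"
    if "u \<in> I" for u
  proof -
    have "((\<lambda>u. f u * f1 u - a * f u) has_real_derivative f1 u * (A u - a)) (at u within I)"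
      using f1_nz[OF that]
      by (auto intro!: derivative_eq_intros f_deriv f1_deriv that simp: A_def kappa_m_def algebra_simps)
    then show ?thesis by (simp add: has_field_derivative_def)
  qed
  have "(\<forall>u\<in>I. A u = a) \<longleftrightarrow> (\<exists>c. \<forall>u\<in>I. f u * f1 u - a * f u = c)"
  proof
    assume "\<forall>u\<in>I. A u = a"
    then show "\<exists>c. \<forall>u\<in>I. f u * f1 u - a * f u = c"
      using d I by (intro has_derivative_zero_constant)
        (auto simp: nondegenerate_interval_def is_interval_convex_1)
  next
    assume "\<exists>c. \<forall>u\<in>I. f u * f1 u - a * f u = c"
    then obtain c where c: "\<And>u. u \<in> I \<Longrightarrow> f u * f1 u - a * f u = c" by blast
    show "\<forall>u\<in>I. A u = a"
    proof
      fix u assume u: "u \<in> I"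
      have "((\<lambda>u. f u * f1 u - a * f u) has_derivative (\<lambda>t. 0)) (at u within I)"
        by (rule has_derivative_transform[OF u c has_derivative_const])
      with d[OF u] have "((\<lambda>u. f u * f1 u - a * f u) has_vector_derivative f1 u * (A u - a)) (at u within I)"
        "((\<lambda>u. f u * f1 u - a * f u) has_vector_derivative 0) (at u within I)"
        by (simp_all add: has_vector_derivative_def mult.commute)
      from vector_derivative_unique_within[OF I_neq_bot[OF u] this] f1_nz[OF u]
      show "A u = a" by simp
    qed
  qed
  then show ?thesis by (simp add: algebra_simps)
qed

lemma A_zero_iff:
  "(\<forall>u\<in>I. A u = 0) \<longleftrightarrow> (\<exists>a c d s :: real. c \<noteq> 0 \<and> s \<in> {1, -1} \<and>
    (\<forall>u\<in>I. c * u + d \<ge> 0 \<and> f u = s * (c * u + d) powr (1 / 2) \<and>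
      g u = - s * (2 / (3 * c\<^sup>2)) * (c * u + d) powr (3 / 2) + a))" (is "_ \<longleftrightarrow> ?meridian")
proof
  assume "\<forall>u\<in>I. A u = 0"
  then obtain k where k: "\<And>u. u \<in> I \<Longrightarrow> f u * f1 u = k"
    using A_const_iff[of 0] by auto
  \<comment> \<open>The derivative of \<open>f * f\<close> is \<open>2 * (f * f1)\<close>, so the
    square of \<open>f\<close> is affine with slope \<open>c\<close>.\<close>
  define c where "c = 2 * k"
  have c: "c \<noteq> 0" using I_nonempty k f_pos f1_nz by (fastforce simp: c_def)
  have cvx: "convex I"
    using I by (simp add: nondegenerate_interval_def is_interval_convex_1)
  have "((\<lambda>u. f u * f u - c * u) has_derivative (\<lambda>t. 0)) (at u within I)" if "u \<in> I" for u
  proof -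
    have "((\<lambda>u. f u * f u - c * u) has_real_derivative 0) (at u within I)"
      using k[OF that] by (auto intro!: derivative_eq_intros f_deriv that simp: c_def)
    then show ?thesis by (simp add: has_field_derivative_def lambda_zero)
  qed
  from has_derivative_zero_constant[OF cvx this] obtain d where d: "\<And>u. u \<in> I \<Longrightarrow> c * u + d = f u * f u"
    by (auto simp: algebra_simps)
  \<comment> \<open>Arc length gives \<open>g1 = - f / c\<close>, and the cube of \<open>f\<close>
    has derivative \<open>3 * c * f / 2\<close>; the factor \<open>2 / (3 * c\<^sup>2)\<close> makes
    the two cancel.\<close>
  have "((\<lambda>u. g u + 2 / (3 * c\<^sup>2) * f u ^ 3) has_derivative (\<lambda>t. 0)) (at u within I)" if u: "u \<in> I" for u
  proof -
    have "g1 u = - f u / c"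
      using g1_eq[OF u] k[OF u] c f1_nz[OF u] f_pos[OF u] by (auto simp: c_def field_simps)
    moreover have "2 / (3 * c\<^sup>2) * (3 * (f u)\<^sup>2 * f1 u) = f u / c"
      using k[OF u] c by (simp add: c_def power2_eq_square field_simps)
    moreover have "((\<lambda>u. g u + r * f u ^ 3) has_real_derivative g1 u + r * (3 * (f u)\<^sup>2 * f1 u))
        (at u within I)" for r
      by (auto intro!: derivative_eq_intros f_deriv g_deriv u)
    note this[of "2 / (3 * c\<^sup>2)"]
    ultimately have "((\<lambda>u. g u + 2 / (3 * c\<^sup>2) * f u ^ 3) has_real_derivative 0) (at u within I)"
      by simp
    then show ?thesis by (simp add: has_field_derivative_def lambda_zero)
  qed
  from has_derivative_zero_constant[OF cvx this] obtain a
    where a: "\<And>u. u \<in> I \<Longrightarrow> g u + 2 / (3 * c\<^sup>2) * f u ^ 3 = a" by auto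
  \<comment> \<open>The sign is \<open>s = 1\<close>, because \<open>f\<close> is positive.\<close>
  have "c * u + d \<ge> 0 \<and> f u = 1 * (c * u + d) powr (1 / 2) \<and>
      g u = - 1 * (2 / (3 * c\<^sup>2)) * (c * u + d) powr (3 / 2) + a" if u: "u \<in> I" for u
  proof -
    have sq: "f u * f u = f u powr 2" using f_pos[OF u] by (simp add: powr_numeral power2_eq_square)
    have "(f u * f u) powr (1 / 2) = f u" "(f u * f u) powr (3 / 2) = f u ^ 3"
      unfolding sq powr_powr using f_pos[OF u] by (simp_all add: powr_numeral)
    with a[OF u] show ?thesis unfolding d[OF u] by simp
  qed
  with c show ?meridian by blast
next
  assume ?meridian
  then obtain c d s where s: "s \<in> {1, - 1 :: real}"
    and cd: "\<And>u. u \<in> I \<Longrightarrow> c * u + d \<ge> 0"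
    and f: "\<And>u. u \<in> I \<Longrightarrow> f u = s * (c * u + d) powr (1 / 2)" by blast
  \<comment> \<open>Either sign squares to 1, so differentiating the affine square yields
    \<open>f * f1 = c / 2\<close>, the case \<open>a = 0\<close> of
    \<open>A_const_iff\<close>.\<close>
  have sq: "f u * f u = c * u + d" if "u \<in> I" for u
    using s cd[OF that] by (auto simp: f[OF that] powr_half_sqrt)
  have "f u * f1 u = c / 2" if u: "u \<in> I" for u
  proof -
    have "((\<lambda>u. f u * f u) has_vector_derivative 2 * (f u * f1 u)) (at u within I)"
      unfolding has_real_derivative_iff_has_vector_derivative[symmetric]
      by (auto intro!: derivative_eq_intros f_deriv u)
    moreover have "((\<lambda>u. c * u + d) has_vector_derivative c) (at u within I)"
      unfolding has_real_derivative_iff_has_vector_derivative[symmetric]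
      by (auto intro!: derivative_eq_intros)
    from has_vector_derivative_transform[OF u sq this]
    have "((\<lambda>u. f u * f u) has_vector_derivative c) (at u within I)" .
    ultimately show ?thesis
      using vector_derivative_unique_within[OF I_neq_bot[OF u]] by fastforce
  qed
  then have "\<forall>u\<in>I. f u * f1 u = 0 * f u + c / 2" by simp
  then show "\<forall>u\<in>I. A u = 0" using A_const_iff by blast
qed

lemma A_nonzero_iff:
  "(\<exists>a. a \<noteq> 0 \<and> (\<forall>u\<in>I. A u = a)) \<longleftrightarrow> (\<exists>a c. a \<noteq> 0 \<and> (\<forall>u\<in>I. f1 u = (c + a * f u) / f u))"
proof -
  have "f u * f1 u = a * f u + c \<longleftrightarrow> f1 u = (c + a * f u) / f u" if "u \<in> I" for a c u
    using f_pos[OF that] by (auto simp: field_simps)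
  then show ?thesis unfolding A_const_iff by blast
qed

end

section \<open>Separation of variables and the two cases\<close>

theorem theorem7p1:
  fixes I J :: "real set" and f g \<phi> :: "real \<Rightarrow> real"
    and b l :: "real \<times> real \<Rightarrow> real ^ 4"
  assumes "meridian_data I J f g \<phi>"
    and "arc_length_meridian I f g"
    and "general_class I J f \<phi>"
    and "\<forall>p \<in> I \<times> J. mink (mean_curvature I J f g \<phi> p) (mean_curvature I J f g \<phi> p) \<noteq> 0"
    and "geometric_normal_frame I J f g \<phi> b l"
  shows "parallel_normal_bundle I J f g \<phi> b l \<longleftrightarrow>
    (\<exists>a c d s :: real. c \<noteq> 0 \<and> s \<in> {1, -1} \<and>
       (\<forall>u\<in>I. c * u + d \<ge> 0 \<and>
          f u = s * (c * u + d) powr (1 / 2) \<and>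
          g u = - s * (2 / (3 * c\<^sup>2)) * (c * u + d) powr (3 / 2) + a))
    \<or> ((\<exists>k :: real. k \<noteq> 0 \<and> (\<forall>v\<in>J. kappa J \<phi> v = k)) \<and>
       (\<exists>a c :: real. a \<noteq> 0 \<and>
          (let y = (\<lambda>t. (c + a * t) / t) in \<forall>u\<in>I. D1 I f u = y (f u)) \<and>
          (\<forall>u\<in>I. D1 I g u = - 1 / (2 * D1 I f u))))"
    (is "_ \<longleftrightarrow> ?a \<or> (?const \<and> ?b)")
proof -
  interpret parabolic_meridian I J f g \<phi>
    by unfold_locales fact+
  have K: "K v \<noteq> 0" if "v \<in> J" for v
    using assms(3) I_nonempty that by (auto simp: general_class_def)
  have "(\<exists>\<mu>. \<forall>u\<in>I. \<forall>v\<in>J. A u = \<mu> * K v)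
    \<longleftrightarrow> (\<forall>u\<in>I. A u = 0) \<or> ?const \<and> (\<exists>a. a \<noteq> 0 \<and> (\<forall>u\<in>I. A u = a))" (is "?L \<longleftrightarrow> ?R")
  proof
    assume ?L
    then obtain \<mu> where \<mu>: "\<And>u v. u \<in> I \<Longrightarrow> v \<in> J \<Longrightarrow> A u = \<mu> * K v" by blast
    obtain u0 v0 where u0: "u0 \<in> I" and v0: "v0 \<in> J" using I_nonempty J_nonempty by blast
    show ?R
    \<comment> \<open>For nonzero \<mu>, fixing \<open>u0\<close> makes \<open>K\<close> constant
      and fixing \<open>v0\<close> makes \<open>A\<close> a nonzero constant; for \<mu> zero,
      \<open>A\<close> vanishes.\<close>
    proof (cases "\<mu> = 0")
      case True
      with \<mu>[OF _ v0] show ?thesis by simp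
    next
      case False
      have "K v = K v0" if "v \<in> J" for v
        using \<mu>[OF u0 that] \<mu>[OF u0 v0] False by simp
      moreover have "\<mu> * K v0 \<noteq> 0" "\<forall>u\<in>I. A u = \<mu> * K v0"
        using False K[OF v0] \<mu>[OF _ v0] by simp_all
      ultimately show ?thesis using K[OF v0] by blast
    qed
  next
    assume ?R
    then show ?L
    proof
      assume "\<forall>u\<in>I. A u = 0"
      then show ?L by (intro exI[of _ 0]) simp
    next
      assume "?const \<and> (\<exists>a. a \<noteq> 0 \<and> (\<forall>u\<in>I. A u = a))"
      then obtain k a where "k \<noteq> 0" "\<forall>v\<in>J. K v = k" "\<forall>u\<in>I. A u = a" by blast
      then show ?L by (intro exI[of _ "a / k"]) simp
    qed
  qed
  \<comment> \<open>The clause on the derivative of \<open>g\<close> is supplied by the arc-length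
    relation through \<open>g1_eq\<close>.\<close>
  moreover have "(\<exists>a. a \<noteq> 0 \<and> (\<forall>u\<in>I. A u = a)) \<longleftrightarrow> ?b"
    unfolding A_nonzero_iff Let_def using g1_eq by auto
  ultimately show ?thesis
    using parallel_iff[OF K _ assms(5)] assms(4) unfolding A_zero_iff by simp
qed

end
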